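(* Let $r\ge 7$. There exists $d_0=d_0(r)$ such that for every $d\ge d_0$ there exists $\lambda\in[0,1]$ with $(r-1)d\lambda^2<1$ for which reconstruction is possible in $\mathrm{BOHT}(2,r,\lambda,d)$ (for integer $d$) and in $\mathrm{BOHT}(2,r,\lambda,\mathrm{Pois}(d))$.
   Context: For integer $r\ge2$ and $\lambda\in[0,1]$, $B_{r,\lambda}:\{\pm\}\to\{\pm\}^{r-1}$ is the kernel $B_{r,\lambda}(x_1,\dots,x_{r-1}|y)=\lambda+2^{-(r-1)}(1-\lambda)$ if $x_i=y$ for all $i$, and $2^{-(r-1)}(1-\lambda)$ otherwise. $\mathrm{BOHT}(2,r,\lambda,D)$ is the broadcasting model on a Galton–Watson $r$-uniform linear hypertree rooted at $\rho$ in which each vertex independently has $t\sim D$ downward hyperedges (each consisting of the vertex and $r-1$ new children); $\sigma_\rho\sim\mathrm{Unif}(\{\pm\})$, and given $\sigma_u$ the children's labels in each downward hyperedge of $u$ are drawn independently across hyperedges from $B_{r,\lambda}(\cdot|\sigma_u)$. $\mathrm{BOHT}(2,r,\lambda,d)$ means $D$ is the point mass at $d$ (every vertex has exactly $d$ downward hyperedges). Reconstruction is possible if $\lim_{k\to\infty}I(\sigma_\rho;T_k,\sigma_{L_k})>0$, where $T_k$ is the set of vertices at distance $\le k$ from $\rho$ and $L_k$ those at distance exactly $k$. *)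

theory Defs
  imports "HOL-Probability.Probability"
begin

(* Observation of the depth-k neighbourhood: the (plane) hypertree structure T_k
   together with the labels of the leaves L_k at depth exactly k.
   OLeaf x : a vertex at depth k (in L_k) with label x (True = +, False = -).
   ONode hs : a vertex at depth < k; hs lists its downward hyperedges, each hyperedge
              given as the list of the observations of its r-1 children. *)
datatype obs = OLeaf bool | ONode "obs list list"

instance obs :: countable
  by countable_datatype

definition B_kernel :: "nat \<Rightarrow> real \<Rightarrow> bool \<Rightarrow> bool list \<Rightarrow> real" where
  "B_kernel r lam y xs =
     (if length xs = r - 1 then
        (if (\<forall>x\<in>set xs. x = y) then lam + (1 - lam) / 2 ^ (r - 1) else (1 - lam) / 2 ^ (r - 1))
      else 0)"

definition B_pmf :: "nat \<Rightarrow> real \<Rightarrow> bool \<Rightarrow> bool list pmf" where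
  "B_pmf r lam y = embed_pmf (B_kernel r lam y)"

primrec list_pmf :: "'a pmf list \<Rightarrow> 'a list pmf" where
  "list_pmf [] = return_pmf []"
| "list_pmf (p # ps) = bind_pmf p (\<lambda>x. bind_pmf (list_pmf ps) (\<lambda>xs. return_pmf (x # xs)))"

primrec bcast :: "nat \<Rightarrow> real \<Rightarrow> nat pmf \<Rightarrow> nat \<Rightarrow> bool \<Rightarrow> obs pmf" where
  "bcast r lam D 0 s = return_pmf (OLeaf s)"
| "bcast r lam D (Suc k) s =
     bind_pmf D (\<lambda>t.
       bind_pmf (list_pmf (replicate t
          (bind_pmf (B_pmf r lam s) (\<lambda>xs. list_pmf (map (bcast r lam D k) xs)))))
       (\<lambda>hs. return_pmf (ONode hs)))"

definition boht_joint :: "nat \<Rightarrow> real \<Rightarrow> nat pmf \<Rightarrow> nat \<Rightarrow> (bool \<times> obs) pmf" where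
  "boht_joint r lam D k =
     bind_pmf (pmf_of_set UNIV) (\<lambda>s. map_pmf (\<lambda>ob. (s, ob)) (bcast r lam D k s))"

definition boht_MI :: "nat \<Rightarrow> real \<Rightarrow> nat pmf \<Rightarrow> nat \<Rightarrow> real" where
  "boht_MI r lam D k =
     prob_space.mutual_information (measure_pmf (boht_joint r lam D k)) 2
       (count_space UNIV) (count_space UNIV) fst snd"

definition reconstructible :: "nat \<Rightarrow> real \<Rightarrow> nat pmf \<Rightarrow> bool" where
  "reconstructible r lam D \<longleftrightarrow> (\<exists>L>0. (\<lambda>k. boht_MI r lam D k) \<longlonglongrightarrow> L)"

end

theory Submission
  imports Defs "HOL-Real_Asymp.Real_Asymp"
begin

text \<open>
  Below the Kesten--Stigum threshold, reconstruction is still achieved by a nonlinear hard-decision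
  recursion. Suppose every child of a vertex carries an estimate of its own label that is wrong with
  probability exactly 1/20. A downward hyperedge casts a vote only if its \<open>r - 1\<close> estimates are
  unanimous, and the vertex adopts the sign of the total vote. For large \<open>d\<close> and
  \<open>(r - 1) d \<lambda>\<^sup>2 = 0.99\<close>, the central limit theorem makes the total vote Gaussian with mean more than
  1.68 standard deviations on the correct side, so that the new estimate is wrong with probability
  below 1/20; adding noise restores the error probability 1/20. Hence at every depth the observation
  can be degraded to a binary symmetric channel with crossover probability 1/20. By data processing
  the mutual information is decreasing in the depth and bounded below by that of this channel.
\<close>

subsection \<open>Products of distributions and the broadcast recursion\<close>

text \<open>Independent draws stay independent under coordinatewise kernels; the inductive step only
  commutes the kernel of the head with the draw of the tail.\<close>

lemma bind_list_pmf_map: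
  "bind_pmf (list_pmf ps) (\<lambda>xs. list_pmf (map K xs)) = list_pmf (map (\<lambda>p. bind_pmf p K) ps)"
proof (induction ps)
  case (Cons p ps)
  have "bind_pmf (list_pmf (p # ps)) (\<lambda>xs. list_pmf (map K xs)) =
      bind_pmf p (\<lambda>x. bind_pmf (list_pmf ps) (\<lambda>xs. bind_pmf (K x) (\<lambda>y.
        bind_pmf (list_pmf (map K xs)) (\<lambda>ys. return_pmf (y # ys)))))"
    by (simp add: bind_assoc_pmf bind_return_pmf)
  also have "\<dots> = bind_pmf p (\<lambda>x. bind_pmf (K x) (\<lambda>y. bind_pmf (list_pmf ps) (\<lambda>xs.
        bind_pmf (list_pmf (map K xs)) (\<lambda>ys. return_pmf (y # ys)))))"
    by (subst bind_commute_pmf) (rule refl)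
  also have "\<dots> = list_pmf (map (\<lambda>p. bind_pmf p K) (p # ps))"
    by (simp add: bind_assoc_pmf flip: Cons.IH)
  finally show ?case .
qed (simp add: bind_return_pmf)

lemma list_pmf_return: "list_pmf (map return_pmf xs) = return_pmf xs"
  by (induction xs) (simp_all add: bind_return_pmf)

lemma map_list_pmf: "map_pmf (map g) (list_pmf ps) = list_pmf (map (map_pmf g) ps)"
proof -
  have "list_pmf (map (\<lambda>x. return_pmf (g x)) xs) = return_pmf (map g xs)" for xs
    using list_pmf_return[of "map g xs"] by (simp add: comp_def)
  then show ?thesis
    using bind_list_pmf_map[of ps "\<lambda>x. return_pmf (g x)"] by (simp add: map_pmf_def[abs_def])
qed

lemma pmf_list_pmf_Cons:
  "pmf (list_pmf (p # ps)) (x # xs) = pmf p x * pmf (list_pmf ps) xs"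
proof -
  have "list_pmf (p # ps) = map_pmf (\<lambda>(x, xs). x # xs) (pair_pmf p (list_pmf ps))"
    by (simp add: pair_pmf_def map_bind_pmf)
  moreover have "inj (\<lambda>(x, xs). x # xs)" by (auto simp: inj_on_def)
  ultimately show ?thesis
    using pmf_map_inj'[of "\<lambda>(x, xs). x # xs" "pair_pmf p (list_pmf ps)" "(x, xs)"] by (simp add: pmf_pair)
qed

lemma set_list_pmf_length: "xs \<in> set_pmf (list_pmf ps) \<Longrightarrow> length xs = length ps"
  by (induction ps arbitrary: xs) auto

lemma pmf_list_pmf_replicate:
  "length xs = n \<Longrightarrow> pmf (list_pmf (replicate n p)) xs = (\<Prod>x\<leftarrow>xs. pmf p x)"
  by (induction xs arbitrary: n) (auto simp: pmf_list_pmf_Cons simp del: list_pmf.simps(2))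

abbreviation unif_bool :: "bool pmf" where
  "unif_bool \<equiv> pmf_of_set UNIV"

text \<open>A coin decides between copying the parent's label to all children and drawing fresh
  uniform labels. The kernel is pointwise the mass function of this mixture, so
  \<open>embed_pmf\<close> returns the mixture itself.\<close>

lemma B_pmf_mixture:
  assumes "0 \<le> lam" "lam \<le> 1"
  shows "B_pmf r lam y = bind_pmf (bernoulli_pmf lam) (\<lambda>c.
     if c then return_pmf (replicate (r - 1) y) else list_pmf (replicate (r - 1) unif_bool))"
    (is "_ = ?M")
proof -
  have u: "pmf (list_pmf (replicate (r - 1) unif_bool)) xs = (if length xs = r - 1 then 1 / 2 ^ (r - 1) else 0)" for xs
  proof (cases "length xs = r - 1")
    case True
    have "(\<Prod>x\<leftarrow>xs. pmf unif_bool x) = (1/2) ^ length xs" by (induction xs) auto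
    then show ?thesis using True by (simp add: pmf_list_pmf_replicate power_divide)
  next
    case False
    then have "xs \<notin> set_pmf (list_pmf (replicate (r - 1) unif_bool))"
      using set_list_pmf_length[of xs "replicate (r - 1) unif_bool"] by auto
    then show ?thesis using False by (simp add: pmf_eq_0_set_pmf)
  qed
  have "B_kernel r lam y = pmf ?M"
  proof
    fix xs :: "bool list"
    have *: "(\<forall>x\<in>set xs. x = y) \<longleftrightarrow> xs = replicate (length xs) y"
    proof
      assume e: "xs = replicate (length xs) y"
      have "set xs \<subseteq> {y}" by (subst e) auto
      then show "\<forall>x\<in>set xs. x = y" by auto
    qed (use replicate_length_same[of xs y] in auto)
    have "pmf ?M xs = lam * indicator {replicate (r - 1) y} xs +
        (1 - lam) * (if length xs = r - 1 then 1 / 2 ^ (r - 1) else 0)"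
      using assms u[of xs] by (simp add: pmf_bind indicator_def)
    then show "B_kernel r lam y xs = pmf ?M xs"
      unfolding B_kernel_def * by (cases "length xs = r - 1") (auto simp: indicator_def)
  qed
  then show ?thesis
    unfolding B_pmf_def by (simp add: type_definition.Rep_inverse[OF td_pmf_embed_pmf])
qed

primrec edges :: "obs \<Rightarrow> obs list list" where
  "edges (OLeaf x) = []"
| "edges (ONode hs) = hs"

text \<open>Processing the child subtrees independently amounts to replacing each child's law by its
  image. Both inductions over the depth, for degradation and for the estimator, rest on
  this.\<close>

lemma bcast_Suc_bind:
  "bind_pmf (bcast r lam D (Suc k) s) (\<lambda>ob. list_pmf (map (\<lambda>h. list_pmf (map F h)) (edges ob))) =
   bind_pmf D (\<lambda>t. list_pmf (replicate t (bind_pmf (B_pmf r lam s)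
     (\<lambda>xs. list_pmf (map (\<lambda>x. bind_pmf (bcast r lam D k x) F) xs)))))"
  by (simp add: bind_assoc_pmf bind_return_pmf bind_list_pmf_map comp_def)

text \<open>Growing one more generation needs only the observed leaf labels, so a single kernel
  serves both root labels.\<close>

lemma bcast_Suc_degraded:
  "\<exists>E. \<forall>s. bcast r lam D (Suc k) s = bind_pmf (bcast r lam D k s) E"
proof (induction k)
  case 0
  show ?case
    by (intro exI[of _ "\<lambda>ob. case ob of OLeaf x \<Rightarrow> bcast r lam D (Suc 0) x | _ \<Rightarrow> return_pmf ob"])
       (simp add: bind_return_pmf)
next
  case (Suc k)
  then obtain E where E: "\<And>s. bind_pmf (bcast r lam D k s) E = bcast r lam D (Suc k) s" by metis
  have "bcast r lam D (Suc (Suc k)) s = bind_pmf (bcast r lam D (Suc k) s)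
      (\<lambda>ob. bind_pmf (list_pmf (map (\<lambda>h. list_pmf (map E h)) (edges ob))) (\<lambda>hs. return_pmf (ONode hs)))" for s
    by (subst bind_assoc_pmf[symmetric], subst bcast_Suc_bind)
       (simp only: E bind_assoc_pmf bcast.simps(2)[of r lam D "Suc k"])
  then show ?case by blast
qed

subsection \<open>Mutual information of a binary label\<close>

text \<open>
  The contribution of one observation, with probabilities \<open>a\<close> and \<open>b\<close> under the two labels, to
  twice the mutual information in bits. Terms with \<open>a = 0\<close> vanish because of the factor, whatever
  the junk value of the logarithm.
\<close>
definition info_term :: "real \<Rightarrow> real \<Rightarrow> real" where
  "info_term a b = a * log 2 (2 * a / (a + b)) + b * log 2 (2 * b / (a + b))"

text \<open>This is \<open>ln x \<le> x - 1\<close> at \<open>x = u / (2 * a / (a + b))\<close>,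
  scaled by \<open>a / ln 2\<close>.\<close>

lemma log_part_le:
  fixes a b u :: real
  assumes "0 \<le> a" "0 \<le> b" "0 \<le> u" "u = 0 \<Longrightarrow> a = 0"
  shows "a * log 2 u - a * log 2 (2 * a / (a + b)) \<le> (u * (a + b) / 2 - a) / ln 2"
proof (cases "a = 0")
  case False
  with assms have pos: "a > 0" "u > 0" "2 * a / (a + b) > 0" "a + b > 0" by (auto simp: less_le)
  have "a * log 2 u - a * log 2 (2 * a / (a + b)) = a * (ln (u / (2 * a / (a + b))) / ln 2)"
    using pos by (subst ln_div) (simp_all add: log_def diff_divide_distrib right_diff_distrib)
  also have "\<dots> \<le> a * ((u / (2 * a / (a + b)) - 1) / ln 2)"
    using pos by (intro mult_left_mono divide_right_mono ln_le_minus_one) auto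
  also have "\<dots> = (u * (a + b) / 2 - a) / ln 2"
    using pos by (simp add: field_simps)
  finally show ?thesis .
qed (use assms in auto)

text \<open>Gibbs' inequality: \<open>u / 2\<close> and \<open>v / 2\<close> are a guess at the
  posterior probabilities \<open>a / (a + b)\<close> and \<open>b / (a + b)\<close>. The two error
  terms of \<open>log_part_le\<close> cancel because \<open>u + v = 2\<close>.\<close>

lemma info_term_ge_linear:
  fixes a b u v :: real
  assumes "0 \<le> a" "0 \<le> b" "0 \<le> u" "0 \<le> v" "u + v = 2" "u = 0 \<Longrightarrow> a = 0" "v = 0 \<Longrightarrow> b = 0"
  shows "a * log 2 u + b * log 2 v \<le> info_term a b"
proof -
  have "(a * log 2 u + b * log 2 v) - info_term a b \<le> (u * (a + b) / 2 - a) / ln 2 + (v * (a + b) / 2 - b) / ln 2"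
    using log_part_le[of a b u] log_part_le[of b a v] assms
    unfolding info_term_def by (simp add: add.commute)
  also have "\<dots> = ((u + v) * (a + b) / 2 - (a + b)) / ln 2"
    by (simp add: field_simps)
  also have "\<dots> = 0" using assms by simp
  finally show ?thesis by simp
qed

lemma info_term_nonneg: "0 \<le> a \<Longrightarrow> 0 \<le> b \<Longrightarrow> 0 \<le> info_term a b"
  using info_term_ge_linear[of a b 1 1] by simp

text \<open>Domination by the summable mass \<open>a + b\<close> gives integrability below. From
  above, the ratio inside the logarithm is at most 2; from below, \<open>log_part_le\<close> applies
  with \<open>u = 1\<close>.\<close>

lemma info_part_bound:
  assumes "0 \<le> a" "0 \<le> b"
  shows "\<bar>a * log 2 (2 * a / (a + b))\<bar> \<le> (a + b) / ln 2"
proof (cases "a = 0")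
  case False
  with assms have a: "a > 0" by simp
  have "log 2 (2 * a / (a + b)) \<le> log 2 2"
    using a assms by (subst log_le_cancel_iff) (auto simp: field_simps)
  then have "a * log 2 (2 * a / (a + b)) \<le> a * 1" using a by (intro mult_left_mono) auto
  also have "a * 1 \<le> (a + b) / 1" using assms by simp
  also have "\<dots> \<le> (a + b) / ln 2" using assms ln_2_less_1 by (intro divide_left_mono) auto
  finally have 1: "a * log 2 (2 * a / (a + b)) \<le> (a + b) / ln 2" .
  have "- (a * log 2 (2 * a / (a + b))) \<le> ((a + b) / 2 - a) / ln 2"
    using log_part_le[of a b 1] assms by simp
  also have "\<dots> \<le> (a + b) / ln 2" using assms by (intro divide_right_mono) auto
  finally show ?thesis using 1 by linarith
qed (use assms in auto)

text \<open>The Jensen-Shannon divergence in bits: the information about a uniform bit carried by an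
  observation with law \<open>P\<close> or \<open>Q\<close>.\<close>

definition binary_info :: "'a pmf \<Rightarrow> 'a pmf \<Rightarrow> real" where
  "binary_info P Q = (\<integral>x. info_term (pmf P x) (pmf Q x) \<partial>count_space UNIV) / 2"

lemma integrable_info_part:
  "integrable (count_space UNIV) (\<lambda>x. pmf P x * log 2 (2 * pmf P x / (pmf P x + pmf Q x)))"
  by (rule Bochner_Integration.integrable_bound[where f="\<lambda>x. (pmf P x + pmf Q x) / ln 2"])
     (auto simp: integrable_pmf intro!: info_part_bound[THEN order_trans])

lemma integrable_info_term:
  "integrable (count_space UNIV) (\<lambda>x. info_term (pmf P x) (pmf Q x))"
  unfolding info_term_def
  using integrable_info_part[of P Q] integrable_info_part[of Q P] by (simp add: add.commute)

lemma pmf_bind_count_space: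
  "pmf (bind_pmf P K) i = (\<integral>x. pmf P x * pmf (K x) i \<partial>count_space UNIV)"
  "integrable (count_space UNIV) (\<lambda>x. pmf P x * pmf (K x) i)"
proof -
  show "pmf (bind_pmf P K) i = (\<integral>x. pmf P x * pmf (K x) i \<partial>count_space UNIV)"
    by (simp add: pmf_bind measure_pmf_eq_density integral_density)
  show "integrable (count_space UNIV) (\<lambda>x. pmf P x * pmf (K x) i)"
    by (rule Bochner_Integration.integrable_bound[where f="pmf P"])
       (auto simp: integrable_pmf pmf_le_1 mult_left_le)
qed

text \<open>
  \<open>info_term\<close> is the supremum of the linear functionals in \<open>info_term_ge_linear\<close>; integrating the
  one that is tight at the output masses gives the log-sum inequality.
\<close>
lemma info_term_bind_le:
  "info_term (pmf (bind_pmf P K) i) (pmf (bind_pmf Q K) i) \<le>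
     (\<integral>x. pmf (K x) i * info_term (pmf P x) (pmf Q x) \<partial>count_space UNIV)"
  "integrable (count_space UNIV) (\<lambda>x. pmf (K x) i * info_term (pmf P x) (pmf Q x))"
proof -
  show int: "integrable (count_space UNIV) (\<lambda>x. pmf (K x) i * info_term (pmf P x) (pmf Q x))"
    by (rule Bochner_Integration.integrable_bound[OF integrable_info_term[of P Q]])
       (auto simp: info_term_nonneg pmf_le_1 mult_left_le_one_le abs_mult)
  define a b where "a = pmf (bind_pmf P K) i" and "b = pmf (bind_pmf Q K) i"
  have nn: "0 \<le> a" "0 \<le> b" by (auto simp: a_def b_def)
  have zero: "pmf R x * pmf (K x) i = 0" if "pmf (bind_pmf R K) i = 0" for R x
    using that by (auto simp: pmf_eq_0_set_pmf)
  show "info_term (pmf (bind_pmf P K) i) (pmf (bind_pmf Q K) i) \<le>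
     (\<integral>x. pmf (K x) i * info_term (pmf P x) (pmf Q x) \<partial>count_space UNIV)"
  proof (cases "a + b = 0")
    case True
    then show ?thesis using nn
      by (fold a_def b_def) (auto simp: info_term_def add_nonneg_eq_0_iff info_term_nonneg[unfolded info_term_def] intro!: integral_nonneg_AE)
  next
    case False
    with nn have ab: "a + b > 0" by simp
    define u v where "u = 2 * a / (a + b)" and "v = 2 * b / (a + b)"
    have "u + v = (2 * (a + b)) / (a + b)" unfolding u_def v_def by (simp only: add_divide_distrib distrib_left)
    also have "\<dots> = 2" using ab by (intro nonzero_divide_eq_eq[THEN iffD2]) auto
    finally have "u + v = 2" .
    then have uv: "0 \<le> u" "0 \<le> v" "u + v = 2" using nn ab by (auto simp: u_def v_def)
    have int_u: "integrable (count_space UNIV) (\<lambda>x. pmf P x * pmf (K x) i * log 2 u)"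
      and int_v: "integrable (count_space UNIV) (\<lambda>x. pmf Q x * pmf (K x) i * log 2 v)"
      by (intro Bochner_Integration.integrable_mult_left pmf_bind_count_space(2))+
    have "info_term a b = a * log 2 u + b * log 2 v" by (simp add: info_term_def u_def v_def)
    also have "\<dots> = (\<integral>x. (pmf P x * pmf (K x) i) * log 2 u + (pmf Q x * pmf (K x) i) * log 2 v \<partial>count_space UNIV)"
      unfolding a_def b_def
      by (simp only: Bochner_Integration.integral_add[OF int_u int_v] integral_mult_left_zero
          pmf_bind_count_space(1)[of P K i] pmf_bind_count_space(1)[of Q K i])
    also have "\<dots> \<le> (\<integral>x. pmf (K x) i * info_term (pmf P x) (pmf Q x) \<partial>count_space UNIV)"
    proof (rule integral_mono[OF _ int])
      show "integrable (count_space UNIV) (\<lambda>x. (pmf P x * pmf (K x) i) * log 2 u + (pmf Q x * pmf (K x) i) * log 2 v)"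
        using int_u int_v by (rule Bochner_Integration.integrable_add)
      fix x
      show "(pmf P x * pmf (K x) i) * log 2 u + (pmf Q x * pmf (K x) i) * log 2 v
          \<le> pmf (K x) i * info_term (pmf P x) (pmf Q x)"
      \<comment> \<open>If \<open>x\<close> cannot produce \<open>i\<close>, both sides vanish.
        Otherwise \<open>u = 0\<close> means \<open>a = 0\<close>, which forces
        \<open>pmf P x = 0\<close>, and likewise for \<open>v\<close>.\<close>
      proof (cases "pmf (K x) i = 0")
        case False
        have "pmf P x * log 2 u + pmf Q x * log 2 v \<le> info_term (pmf P x) (pmf Q x)"
          using uv ab zero[of P x] zero[of Q x] False
          by (intro info_term_ge_linear) (auto simp: u_def v_def a_def b_def)
        from mult_left_mono[OF this, of "pmf (K x) i"] show ?thesis by (simp add: algebra_simps)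
      qed auto
    qed
    finally show ?thesis by (simp add: a_def b_def)
  qed
qed

text \<open>The log-sum inequality is summed over the outputs \<open>i\<close>. With nonnegative
  integrals the two sums may be exchanged, and each \<open>K x\<close> has total mass 1.\<close>

lemma binary_info_data_processing:
  "binary_info (bind_pmf P K) (bind_pmf Q K) \<le> binary_info P Q"
proof -
  let ?h = "\<lambda>x. info_term (pmf P x) (pmf Q x)"
  have "(\<integral>\<^sup>+i. info_term (pmf (bind_pmf P K) i) (pmf (bind_pmf Q K) i) \<partial>count_space UNIV)
      \<le> (\<integral>\<^sup>+i. (\<integral>\<^sup>+x. ennreal (pmf (K x) i * ?h x) \<partial>count_space UNIV) \<partial>count_space UNIV)"
  proof (rule nn_integral_mono)
    fix i
    show "ennreal (info_term (pmf (bind_pmf P K) i) (pmf (bind_pmf Q K) i))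
        \<le> (\<integral>\<^sup>+x. ennreal (pmf (K x) i * ?h x) \<partial>count_space UNIV)"
      by (subst nn_integral_eq_integral[OF info_term_bind_le(2)])
         (auto simp: info_term_nonneg intro!: ennreal_leI info_term_bind_le(1))
  qed
  also have "\<dots> = (\<integral>\<^sup>+x. (\<integral>\<^sup>+i. ennreal (pmf (K x) i * ?h x) \<partial>count_space UNIV) \<partial>count_space UNIV)"
    using nn_integral_fst_count_space[of "\<lambda>(i, x). ennreal (pmf (K x) i * ?h x)"]
      nn_integral_snd_count_space[of "\<lambda>(i, x). ennreal (pmf (K x) i * ?h x)"] by simp
  also have "\<dots> = (\<integral>\<^sup>+x. ?h x \<partial>count_space UNIV)"
    by (intro nn_integral_cong)
       (simp add: ennreal_mult' info_term_nonneg nn_integral_multc nn_integral_pmf_eq_1)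
  finally have "(\<integral>\<^sup>+i. info_term (pmf (bind_pmf P K) i) (pmf (bind_pmf Q K) i) \<partial>count_space UNIV) \<le> (\<integral>\<^sup>+x. ?h x \<partial>count_space UNIV)" .
  then have "ennreal (\<integral>i. info_term (pmf (bind_pmf P K) i) (pmf (bind_pmf Q K) i) \<partial>count_space UNIV)
      \<le> ennreal (\<integral>x. ?h x \<partial>count_space UNIV)"
    by (simp add: nn_integral_eq_integral integrable_info_term info_term_nonneg)
  then show ?thesis
    unfolding binary_info_def
    by (subst (asm) ennreal_le_iff) (auto intro!: integral_nonneg_AE simp: info_term_nonneg)
qed

text \<open>The label has marginal 1/2 and the observation the average of both laws, so the density
  ratio is \<open>2 * a / (a + b)\<close> with \<open>a\<close> the mass under the given label and
  \<open>b\<close> that under the other. Countability makes the product of the counting measures a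
  counting measure.\<close>

lemma mutual_information_binary_info:
  fixes P :: "bool \<Rightarrow> 'a::countable pmf"
  defines "J \<equiv> bind_pmf (pmf_of_set UNIV) (\<lambda>s. map_pmf (\<lambda>ob. (s, ob)) (P s))"
  shows "prob_space.mutual_information (measure_pmf J) 2 (count_space UNIV) (count_space UNIV) fst snd
    = binary_info (P True) (P False)"
proof -
  interpret information_space "measure_pmf J" 2
    by unfold_locales simp
  have J: "pmf J (s, ob) = pmf (P s) ob / 2" for s ob
  proof -
    have "pmf (map_pmf (\<lambda>ob. (s', ob)) (P s')) (s, ob) = (if s' = s then pmf (P s) ob else 0)" for s'
    proof (cases "s' = s")
      case True
      then show ?thesis by (simp add: pmf_map_inj' inj_on_def)
    qed (auto simp: pmf_eq_0_set_pmf)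
    then show ?thesis unfolding J_def by (cases s) (simp_all add: pmf_bind_pmf_of_set UNIV_bool)
  qed
  have map_fst: "map_pmf fst J = pmf_of_set UNIV"
    unfolding J_def by (simp add: map_bind_pmf pmf.map_comp comp_def map_pmf_const bind_return_pmf')
  have map_snd: "pmf (map_pmf snd J) ob = (pmf (P True) ob + pmf (P False) ob) / 2" for ob
    unfolding J_def by (simp add: map_bind_pmf pmf.map_comp comp_def pmf_bind_pmf_of_set UNIV_bool)
  have prod: "count_space UNIV \<Otimes>\<^sub>M count_space UNIV = (count_space UNIV :: (bool \<times> 'a) measure)"
    using pair_measure_countable[of "UNIV :: bool set" "UNIV :: 'a set"] by simp
  have distr: "distributed J (count_space UNIV) X (\<lambda>x. ennreal (pmf (map_pmf X J) x))" for X :: "bool \<times> 'a \<Rightarrow> 'b"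
    unfolding distributed_def by (simp flip: measure_pmf_eq_density) (simp add: map_pmf_rep_eq)
  let ?f = "\<lambda>x. pmf J x * log 2 (pmf J x / (pmf (map_pmf fst J) (fst x) * pmf (map_pmf snd J) (snd x)))"
  let ?g = "\<lambda>s ob. pmf (P s) ob * log 2 (2 * pmf (P s) ob / (pmf (P s) ob + pmf (P (\<not> s)) ob)) / 2"
  have f: "?f (s, ob) = ?g s ob" for s ob
    by (cases s) (simp_all add: J map_fst map_snd add.commute)
  have int_g: "integrable (count_space UNIV) (?g s)" for s
    using integrable_info_part[of "P s" "P (\<not> s)"] by simp
  interpret A: sigma_finite_measure "count_space (UNIV :: bool set)"
    by (rule sigma_finite_measure_count_space_countable) simp
  interpret B: sigma_finite_measure "count_space (UNIV :: 'a set)"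
    by (rule sigma_finite_measure_count_space_countable) simp
  interpret AB: pair_sigma_finite "count_space (UNIV :: bool set)" "count_space (UNIV :: 'a set)" ..
  have "prob_space.mutual_information (measure_pmf J) 2 (count_space UNIV) (count_space UNIV) fst snd
      = integral\<^sup>L (count_space UNIV \<Otimes>\<^sub>M count_space UNIV) ?f"
    using distr[of fst] distr[of snd] distr[of "\<lambda>x. x"]
    by (intro mutual_information_distr) (auto simp: prod pmf.map_ident A.sigma_finite_measure_axioms B.sigma_finite_measure_axioms)
  also have "\<dots> = (\<integral>(s, ob). ?g s ob \<partial>(count_space UNIV \<Otimes>\<^sub>M count_space UNIV))"
    by (rule arg_cong[where f="integral\<^sup>L _"]) (auto simp only: fun_eq_iff f split_paired_all prod.case)
  also have "\<dots> = (\<integral>s. (\<integral>ob. ?g s ob \<partial>count_space UNIV) \<partial>count_space UNIV)"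
  proof -
    have "integrable (count_space UNIV \<Otimes>\<^sub>M count_space UNIV) (\<lambda>(s, ob). ?g s ob)"
    proof (rule AB.Fubini_integrable)
      show "(\<lambda>(s, ob). ?g s ob) \<in> borel_measurable (count_space UNIV \<Otimes>\<^sub>M count_space UNIV)"
        by (simp add: prod)
    qed (use int_g in \<open>auto intro!: integrable_count_space\<close>)
    from AB.integral_fst'[OF this] show ?thesis by simp
  qed
  also have "\<dots> = (\<integral>ob. ?g True ob \<partial>count_space UNIV) + (\<integral>ob. ?g False ob \<partial>count_space UNIV)"
    by (subst lebesgue_integral_count_space_finite) (simp_all add: UNIV_bool)
  also have "\<dots> = (\<integral>ob. ?g True ob + ?g False ob \<partial>count_space UNIV)"
    by (rule Bochner_Integration.integral_add[symmetric]) (rule int_g)+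
  also have "\<dots> = (\<integral>ob. info_term (pmf (P True) ob) (pmf (P False) ob) / 2 \<partial>count_space UNIV)"
    by (simp add: info_term_def add_divide_distrib add.commute)
  also have "\<dots> = binary_info (P True) (P False)"
    by (simp add: binary_info_def)
  finally show ?thesis .
qed

subsection \<open>Central limit theorem for triangular arrays of ternary votes\<close>

definition char_pmf :: "real pmf \<Rightarrow> real \<Rightarrow> complex" where
  "char_pmf p u = measure_pmf.expectation p (\<lambda>x. iexp (u * x))"

definition random_sum :: "nat pmf \<Rightarrow> real pmf \<Rightarrow> real pmf" where
  "random_sum D p = bind_pmf D (\<lambda>t. map_pmf sum_list (list_pmf (replicate t p)))"

lemma integrable_pmf_bounded:
  fixes f :: "'a \<Rightarrow> 'b::{banach, second_countable_topology}"
  assumes "\<And>x. norm (f x) \<le> B"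
  shows "integrable (measure_pmf p) f"
  by (rule measure_pmf.integrable_const_bound[where B=B]) (use assms in auto)

lemma expectation_bind_pmf_real:
  fixes f :: "'b \<Rightarrow> real"
  assumes "\<And>x. \<bar>f x\<bar> \<le> B"
  shows "measure_pmf.expectation (bind_pmf p K) f = measure_pmf.expectation p (\<lambda>x. measure_pmf.expectation (K x) f)"
  unfolding measure_pmf_bind
  by (rule integral_bind[where K="count_space UNIV" and B'=1 and B=B])
     (use assms in \<open>auto simp: measure_pmf.emeasure_space_1 space_subprob_algebra prob_space_imp_subprob_space
       measure_pmf.prob_space_axioms\<close>)

lemma norm_expectation_pmf_le:
  fixes f :: "'a \<Rightarrow> 'b::{banach, second_countable_topology}"
  assumes "\<And>x. norm (f x) \<le> B"
  shows "norm (measure_pmf.expectation p f) \<le> B"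
proof -
  have "norm (measure_pmf.expectation p f) \<le> measure_pmf.expectation p (\<lambda>x. norm (f x))"
    by (rule integral_norm_bound)
  also have "\<dots> \<le> measure_pmf.expectation p (\<lambda>_. B)"
    using assms by (intro integral_mono integrable_pmf_bounded[where B=B] integrable_pmf_bounded[where B="\<bar>B\<bar>"]) auto
  finally show ?thesis by simp
qed

lemma expectation_bind_pmf_complex:
  fixes f :: "'b \<Rightarrow> complex"
  assumes "\<And>x. norm (f x) \<le> B"
  shows "measure_pmf.expectation (bind_pmf p K) f = measure_pmf.expectation p (\<lambda>x. measure_pmf.expectation (K x) f)"
proof -
  have int: "integrable (measure_pmf q) f" for q
    by (rule integrable_pmf_bounded) (rule assms)
  have intK: "integrable (measure_pmf p) (\<lambda>x. measure_pmf.expectation (K x) f)"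
    by (rule integrable_pmf_bounded) (rule norm_expectation_pmf_le, rule assms)
  have b: "\<bar>Re (f x)\<bar> \<le> B" "\<bar>Im (f x)\<bar> \<le> B" for x
    using assms[of x] abs_Re_le_cmod[of "f x"] abs_Im_le_cmod[of "f x"] by linarith+
  show ?thesis
    by (rule complex_eqI)
       (simp_all flip: integral_Re[OF int] integral_Im[OF int] integral_Re[OF intK] integral_Im[OF intK]
          add: expectation_bind_pmf_real[OF b(1)] expectation_bind_pmf_real[OF b(2)])
qed

lemma norm_char_pmf_le_1: "norm (char_pmf p u) \<le> 1"
  unfolding char_pmf_def by (rule norm_expectation_pmf_le) simp

lemma char_pmf_sum_list: "char_pmf (map_pmf sum_list (list_pmf (replicate t p))) u = char_pmf p u ^ t"
proof (induction t)
  case (Suc t)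
  have "map_pmf sum_list (list_pmf (replicate (Suc t) p)) =
    bind_pmf p (\<lambda>x. map_pmf (\<lambda>y. x + y) (map_pmf sum_list (list_pmf (replicate t p))))"
    by (simp add: map_bind_pmf map_pmf_comp) (simp add: map_pmf_def)
  then have "char_pmf (map_pmf sum_list (list_pmf (replicate (Suc t) p))) u
      = measure_pmf.expectation p (\<lambda>x. measure_pmf.expectation (map_pmf sum_list (list_pmf (replicate t p)))
           (\<lambda>y. iexp (u * (x + y))))"
    unfolding char_pmf_def
    by (simp add: expectation_bind_pmf_complex[where B=1])
  also have "\<dots> = measure_pmf.expectation p (\<lambda>x. iexp (u * x) * char_pmf p u ^ t)"
    by (simp only: distrib_left of_real_add exp_add integral_mult_right_zero flip: Suc.IH char_pmf_def)
  also have "\<dots> = char_pmf p u ^ Suc t"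
    by (simp add: char_pmf_def)
  finally show ?case .
qed (simp add: char_pmf_def)

lemma char_pmf_random_sum:
  "char_pmf (random_sum D p) u = measure_pmf.expectation D (\<lambda>t. char_pmf p u ^ t)"
  using expectation_bind_pmf_complex[of "\<lambda>x. iexp (u * x)" 1 D "\<lambda>t. map_pmf sum_list (list_pmf (replicate t p))"]
    char_pmf_sum_list[of _ p u]
  unfolding char_pmf_def random_sum_def by simp

text \<open>Written around 1 so that, for small \<open>u\<close>, the real part shows the second
  moment and the imaginary part the mean.\<close>

lemma char_pmf_ternary:
  assumes "set_pmf p \<subseteq> {-1, 0, 1}"
  shows "char_pmf p u = 1 + of_real ((pmf p 1 + pmf p (-1)) * (cos u - 1)) + \<i> * of_real ((pmf p 1 - pmf p (-1)) * sin u)"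
proof -
  have "sum (pmf p) {-1, 0, 1} = 1"
    using assms by (intro sum_pmf_eq_1) auto
  then have p0: "pmf p 0 = 1 - pmf p 1 - pmf p (-1)" by simp
  have "char_pmf p u = (\<Sum>x\<in>{-1, 0, 1}. pmf p x *\<^sub>R iexp (u * x))"
    unfolding char_pmf_def using assms by (intro integral_measure_pmf) auto
  then show ?thesis
    by (simp add: p0 complex_eq_iff Re_exp Im_exp algebra_simps)
qed

lemma expectation_poisson_power:
  fixes z :: complex
  assumes "d > 0" "norm z \<le> 1"
  shows "measure_pmf.expectation (poisson_pmf d) (\<lambda>t. z ^ t) = exp (of_real d * (z - 1))"
proof -
  have int: "integrable (measure_pmf (poisson_pmf d)) (\<lambda>t. z ^ t)"
    by (rule integrable_pmf_bounded[where B=1]) (use assms in \<open>simp add: norm_power power_le_one\<close>)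
  then have int': "integrable (count_space UNIV) (\<lambda>t. pmf (poisson_pmf d) t *\<^sub>R z ^ t)"
    unfolding measure_pmf_eq_density by (subst (asm) integrable_density) auto
  have "(\<lambda>t. pmf (poisson_pmf d) t *\<^sub>R z ^ t) sums measure_pmf.expectation (poisson_pmf d) (\<lambda>t. z ^ t)"
    using sums_integral_count_space_nat[OF int']
    unfolding measure_pmf_eq_density by (subst integral_density) auto
  moreover have "(\<lambda>t. exp (- of_real d) * ((of_real d * z) ^ t /\<^sub>R fact t)) sums (exp (- of_real d) * exp (of_real d * z))"
    by (intro sums_mult exp_converges)
  moreover have "pmf (poisson_pmf d) t *\<^sub>R z ^ t = exp (- of_real d) * ((of_real d * z) ^ t /\<^sub>R fact t)" for t
    using assms by (simp add: scaleR_conv_of_real power_mult_distrib divide_inverse exp_of_real[symmetric])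
  ultimately show ?thesis
    by (simp add: sums_unique2 algebra_simps flip: exp_add)
qed

text \<open>
  The only property of the offspring laws \<open>D n\<close> that the central limit theorem below needs. It covers
  both the constant and the Poisson offspring numbers.
\<close>
definition poisson_like :: "(nat \<Rightarrow> real) \<Rightarrow> (nat \<Rightarrow> nat pmf) \<Rightarrow> bool" where
  "poisson_like d D \<longleftrightarrow> (\<forall>z L. (\<forall>n. norm (z n) \<le> 1) \<longrightarrow> (\<lambda>n. of_real (d n) * (z n - 1)) \<longlonglongrightarrow> L \<longrightarrow>
     (\<lambda>n. measure_pmf.expectation (D n) (\<lambda>t. z n ^ t)) \<longlonglongrightarrow> exp (L :: complex))"

lemma poisson_like_poisson:
  assumes "filterlim d at_top sequentially"
  shows "poisson_like d (\<lambda>n. poisson_pmf (d n))"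
  unfolding poisson_like_def
proof (intro allI impI)
  fix z L assume z: "\<forall>n. norm (z n) \<le> 1" and L: "(\<lambda>n. of_real (d n) * (z n - 1)) \<longlonglongrightarrow> (L::complex)"
  have "eventually (\<lambda>n. d n > 0) sequentially"
    using assms by (simp add: filterlim_at_top_dense)
  then have "eventually (\<lambda>n. exp (of_real (d n) * (z n - 1)) =
      measure_pmf.expectation (poisson_pmf (d n)) (\<lambda>t. z n ^ t)) sequentially"
    by eventually_elim (use z in \<open>simp add: expectation_poisson_power\<close>)
  then show "(\<lambda>n. measure_pmf.expectation (poisson_pmf (d n)) (\<lambda>t. z n ^ t)) \<longlonglongrightarrow> exp L"
    using tendsto_exp[OF L] by (rule Lim_transform_eventually[rotated])
qed

text \<open>The complex form of \<open>(1 + L / n) ^ n\<close> tending to \<open>exp L\<close>: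
  \<open>z n\<close> and \<open>exp (z n - 1)\<close> differ by a quadratic error, and the power
  \<open>n\<close> costs at most a factor \<open>n\<close>.\<close>

lemma poisson_like_fixed: "poisson_like real return_pmf"
  unfolding poisson_like_def
proof (intro allI impI)
  fix z :: "nat \<Rightarrow> complex" and L
  assume z: "\<forall>n. norm (z n) \<le> 1" and L: "(\<lambda>n. of_real (real n) * (z n - 1)) \<longlonglongrightarrow> (L::complex)"
  have inv: "(\<lambda>n. 1 / of_real (real n) :: complex) \<longlonglongrightarrow> 0"
    using lim_1_over_n[where 'a=complex] by simp
  have "(\<lambda>n. (of_real (real n) * (z n - 1)) * (1 / of_real (real n))) \<longlonglongrightarrow> L * 0"
    by (intro tendsto_mult L inv)
  then have w0: "(\<lambda>n. z n - 1) \<longlonglongrightarrow> 0"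
    unfolding mult_zero_right
    by (rule Lim_transform_eventually) (rule eventually_mono[OF eventually_gt_at_top[of 0]], simp)
  have err: "norm (1 + w - exp w) \<le> 3 * norm w ^ 2" if "norm w \<le> 1" for w :: complex
  proof -
    have "norm (exp w - (\<Sum>i\<le>1. w ^ i / fact i)) \<le> exp \<bar>Re w\<bar> * norm w ^ Suc 1 / fact 1"
      by (rule Taylor_exp)
    also have "\<dots> \<le> 3 * norm w ^ 2"
    proof -
      have "\<bar>Re w\<bar> \<le> 1" using that abs_Re_le_cmod[of w] by linarith
      then have "exp \<bar>Re w\<bar> \<le> exp 1" by simp
      then have "exp \<bar>Re w\<bar> \<le> 3" using exp_le by linarith
      then show ?thesis by (simp add: mult_right_mono power2_eq_square)
    qed
    finally show ?thesis by (simp add: norm_minus_commute)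
  qed
  have "(\<lambda>n. z n ^ n - exp (z n - 1) ^ n) \<longlonglongrightarrow> 0"
  proof (rule Lim_null_comparison)
    have "eventually (\<lambda>n. norm (z n - 1) < 1) sequentially"
      using tendstoD[OF w0, of 1] by (simp add: dist_norm)
    then show "eventually (\<lambda>n. norm (z n ^ n - exp (z n - 1) ^ n) \<le>
        3 * (norm (of_real (real n) * (z n - 1)) * norm (z n - 1))) sequentially"
    proof eventually_elim
      case (elim n)
      \<comment> \<open>This puts \<open>exp (z n - 1)\<close> in the closed unit disc, as the bound
        for differences of powers requires.\<close>
      have "Re (z n) \<le> 1" using z complex_Re_le_cmod[of "z n"] by (meson order_trans)
      then have "norm (z n ^ n - exp (z n - 1) ^ n) \<le> n * norm (z n - exp (z n - 1))"
        using z by (intro norm_power_diff) auto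
      also have "\<dots> \<le> n * (3 * norm (z n - 1) ^ 2)"
        using err[of "z n - 1"] elim by (intro mult_left_mono) auto
      finally show ?case by (simp add: norm_mult power2_eq_square mult.assoc)
    qed
    show "(\<lambda>n. 3 * (norm (of_real (real n) * (z n - 1)) * norm (z n - 1))) \<longlonglongrightarrow> 0"
      using tendsto_mult_left[OF tendsto_mult[OF tendsto_norm[OF L] tendsto_norm[OF w0]], of 3] by simp
  qed
  moreover have "(\<lambda>n. exp (z n - 1) ^ n) \<longlonglongrightarrow> exp L"
    using tendsto_exp[OF L] by (simp add: exp_of_nat_mult)
  ultimately have "(\<lambda>n. (z n ^ n - exp (z n - 1) ^ n) + exp (z n - 1) ^ n) \<longlonglongrightarrow> 0 + exp L"
    by (rule tendsto_add)
  then show "(\<lambda>n. measure_pmf.expectation (return_pmf n) (\<lambda>t. z n ^ t)) \<longlonglongrightarrow> exp L"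
    by simp
qed

text \<open>Votes have mean of order \<open>1 / sqrt (d n)\<close>, so for Poisson offspring the
  fluctuation of their number leaves the limiting variance unchanged, and constant offspring give
  the same limit. The sign is reversed so that small sums become large values.\<close>

lemma weak_conv_ternary_sum:
  fixes d :: "nat \<Rightarrow> real" and p :: "nat \<Rightarrow> real pmf"
  assumes d: "filterlim d at_top sequentially" and D: "poisson_like d D"
    and p: "\<And>n. set_pmf (p n) \<subseteq> {-1, 0, 1}" and v: "v > 0"
    and var: "(\<lambda>n. pmf (p n) 1 + pmf (p n) (-1)) \<longlonglongrightarrow> v"
    and mean: "(\<lambda>n. sqrt (d n) * (pmf (p n) 1 - pmf (p n) (-1))) \<longlonglongrightarrow> m"
  shows "weak_conv_m (\<lambda>n. distr (random_sum (D n) (p n)) borel (\<lambda>s. m / sqrt v - s / sqrt (v * d n)))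
    std_normal_distribution"
proof (rule levy_continuity)
  fix t
  define \<theta> where "\<theta> n = - t / sqrt (v * d n)" for n
  have \<theta>: "\<theta> n = - ((t / sqrt v) / sqrt (d n))" for n
    by (simp add: \<theta>_def real_sqrt_mult)
  have "((\<lambda>x. x * (cos (- (a / sqrt x)) - 1)) \<longlongrightarrow> - (a * a / 2)) at_top" for a :: real
    by real_asymp
  from filterlim_compose[OF this d] have "(\<lambda>n. d n * (cos (\<theta> n) - 1)) \<longlonglongrightarrow> - ((t / sqrt v) * (t / sqrt v) / 2)"
    unfolding \<theta> .
  moreover have "(t / sqrt v) * (t / sqrt v) / 2 = t\<^sup>2 / (2 * v)"
    using v by (simp add: power2_eq_square)
  ultimately have c: "(\<lambda>n. d n * (cos (\<theta> n) - 1)) \<longlonglongrightarrow> - t\<^sup>2 / (2 * v)"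
    by simp
  have "((\<lambda>x. sqrt x * sin (- (a / sqrt x))) \<longlongrightarrow> - a) at_top" for a :: real
    by real_asymp
  from filterlim_compose[OF this d, of "t / sqrt v"] have s: "(\<lambda>n. sqrt (d n) * sin (\<theta> n)) \<longlonglongrightarrow> - t / sqrt v"
    unfolding \<theta> by simp
  let ?z = "\<lambda>n. char_pmf (p n) (\<theta> n)"
  \<comment> \<open>The cosine is second order and yields the Gaussian exponent. The sine is first
    order and meets a mean of order \<open>1 / sqrt (d n)\<close>, so there the factor
    \<open>d n\<close> is split into two square roots.\<close>
  have "(\<lambda>n. of_real ((pmf (p n) 1 + pmf (p n) (-1)) * (d n * (cos (\<theta> n) - 1))) +
      \<i> * of_real ((sqrt (d n) * (pmf (p n) 1 - pmf (p n) (-1))) * (sqrt (d n) * sin (\<theta> n))))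
      \<longlonglongrightarrow> of_real (v * (- t\<^sup>2 / (2 * v))) + \<i> * of_real (m * (- t / sqrt v))"
    by (intro tendsto_intros var mean c s)
  moreover have "eventually (\<lambda>n. of_real ((pmf (p n) 1 + pmf (p n) (-1)) * (d n * (cos (\<theta> n) - 1))) +
      \<i> * of_real ((sqrt (d n) * (pmf (p n) 1 - pmf (p n) (-1))) * (sqrt (d n) * sin (\<theta> n)))
      = of_real (d n) * (?z n - 1)) sequentially"
  proof -
    have "eventually (\<lambda>n. d n > 0) sequentially"
      using d by (simp add: filterlim_at_top_dense)
    then show ?thesis
    proof eventually_elim
      case (elim n)
      have "(sqrt (d n) * x) * (sqrt (d n) * y) = d n * (x * y)" for x y
        using elim by (simp add: mult.assoc mult.left_commute[of x])
      then show ?case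
        by (simp only: char_pmf_ternary[OF p]) (simp add: algebra_simps)
    qed
  qed
  ultimately have "(\<lambda>n. of_real (d n) * (?z n - 1)) \<longlonglongrightarrow> of_real (v * (- t\<^sup>2 / (2 * v))) + \<i> * of_real (m * (- t / sqrt v))"
    by (rule Lim_transform_eventually)
  then have "(\<lambda>n. measure_pmf.expectation (D n) (\<lambda>k. ?z n ^ k)) \<longlonglongrightarrow>
      exp (of_real (v * (- t\<^sup>2 / (2 * v))) + \<i> * of_real (m * (- t / sqrt v)))"
    using D[unfolded poisson_like_def, rule_format, of ?z, OF norm_char_pmf_le_1] by simp
  then have "(\<lambda>n. iexp (t * (m / sqrt v)) * char_pmf (random_sum (D n) (p n)) (\<theta> n)) \<longlonglongrightarrow>
      iexp (t * (m / sqrt v)) * exp (of_real (v * (- t\<^sup>2 / (2 * v))) + \<i> * of_real (m * (- t / sqrt v)))"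
    unfolding char_pmf_random_sum by (intro tendsto_intros)
  moreover have "iexp (t * (m / sqrt v)) * exp (of_real (v * (- t\<^sup>2 / (2 * v))) + \<i> * of_real (m * (- t / sqrt v)))
     = char std_normal_distribution t"
    using v unfolding char_std_normal_distribution by (simp flip: exp_add exp_of_real)
  moreover have "iexp (t * (m / sqrt v)) * char_pmf (random_sum (D n) (p n)) (\<theta> n) =
      char (distr (random_sum (D n) (p n)) borel (\<lambda>s. m / sqrt v - s / sqrt (v * d n))) t" for n
  proof -
    have "char (distr (random_sum (D n) (p n)) borel (\<lambda>s. m / sqrt v - s / sqrt (v * d n))) t
      = measure_pmf.expectation (random_sum (D n) (p n)) (\<lambda>s. iexp (t * (m / sqrt v - s / sqrt (v * d n))))"
      unfolding char_def by (subst integral_distr) auto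
    also have "\<dots> = measure_pmf.expectation (random_sum (D n) (p n)) (\<lambda>s. iexp (t * (m / sqrt v)) * iexp (\<theta> n * s))"
      by (intro Bochner_Integration.integral_cong refl)
         (simp add: \<theta>_def algebra_simps flip: exp_add)
    finally show ?thesis by (simp add: char_pmf_def)
  qed
  ultimately show "(\<lambda>n. char (distr (random_sum (D n) (p n)) borel (\<lambda>s. m / sqrt v - s / sqrt (v * d n))) t)
     \<longlonglongrightarrow> char std_normal_distribution t" by (simp only:)
qed (auto intro!: real_dist_normal_dist prob_space.real_distribution_distr[OF measure_pmf.prob_space_axioms])

subsection \<open>Gaussian tail\<close>

lemma DERIV_std_normal_density:
  "(std_normal_density has_real_derivative - x * std_normal_density x) (at x)"
  unfolding std_normal_density_def
  by (auto intro!: derivative_eq_intros simp: field_simps power2_eq_square)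

text \<open>
  The rational factor is the third convergent of the continued fraction of the Mills ratio. The
  simpler bound \<open>1 / x\<close> is too weak for the value 1.68 below.
\<close>
lemma std_normal_tail_le:
  assumes "x > 0"
  shows "measure std_normal_distribution {x<..} \<le> std_normal_density x * ((x\<^sup>2 + 2) / (x ^ 3 + 3 * x))"
proof -
  define R where "R y = (y\<^sup>2 + 2) / (y ^ 3 + 3 * y)" for y :: real
  define R' where "R' y = - (y ^ 4 + 3 * y\<^sup>2 + 6) / (y * (y\<^sup>2 + 3))\<^sup>2" for y :: real
  \<comment> \<open>The derivative of \<open>- (std_normal_density y * R y)\<close>, so that its
    integral over \<open>{x..}\<close> is explicit.\<close>
  define g where "g y = std_normal_density y * (y * R y - R' y)" for y
  have dR: "(R has_real_derivative R' y) (at y)" if "y > 0" for y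
  proof -
    have nz: "y ^ 3 + 3 * y \<noteq> 0" using that by (simp add: add_pos_pos less_imp_neq[symmetric])
    have "(R has_real_derivative ((2 * y) * (y ^ 3 + 3 * y) - (y\<^sup>2 + 2) * (3 * y\<^sup>2 + 3)) / ((y ^ 3 + 3 * y) * (y ^ 3 + 3 * y))) (at y)"
      unfolding R_def using nz by (auto intro!: derivative_eq_intros)
    also have "((2 * y) * (y ^ 3 + 3 * y) - (y\<^sup>2 + 2) * (3 * y\<^sup>2 + 3)) = - (y ^ 4 + 3 * y\<^sup>2 + 6)"
      by (simp add: algebra_simps power2_eq_square power3_eq_cube power4_eq_xxxx)
    also have "(y ^ 3 + 3 * y) * (y ^ 3 + 3 * y) = (y * (y\<^sup>2 + 3))\<^sup>2"
      by (simp add: algebra_simps power2_eq_square power3_eq_cube)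
    finally show ?thesis by (simp add: R'_def)
  qed
  \<comment> \<open>Hence \<open>g\<close> dominates the density. Over a common denominator the
    claim compares \<open>y ^ 4 + 3 * y\<^sup>2\<close> with
    \<open>y ^ 4 + 3 * y\<^sup>2 + 6\<close>.\<close>
  have ge1: "y * R y - R' y \<ge> 1" if "y > 0" for y
  proof -
    have p: "y\<^sup>2 + 3 > 0" "y\<^sup>2 > 0" using that by (auto intro: add_nonneg_pos)
    have "y * R y = (y\<^sup>2 + 2) / (y\<^sup>2 + 3)"
    proof -
      have "y ^ 3 + 3 * y = y * (y\<^sup>2 + 3)" by (simp add: algebra_simps power2_eq_square power3_eq_cube)
      then show ?thesis using that by (simp add: R_def)
    qed
    also have "\<dots> = ((y\<^sup>2 + 3) - 1) / (y\<^sup>2 + 3)" by simp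
    also have "\<dots> = 1 - 1 / (y\<^sup>2 + 3)" 
    proof -
      have "y\<^sup>2 + 3 \<noteq> 0" using p(1) by linarith
      then show ?thesis by (subst diff_divide_distrib) simp
    qed
    finally have 1: "y * R y = 1 - 1 / (y\<^sup>2 + 3)" .
    have "1 / (y\<^sup>2 + 3) = (y\<^sup>2 * (y\<^sup>2 + 3)) / (y * (y\<^sup>2 + 3))\<^sup>2"
      using p that by (simp add: power2_eq_square)
    also have "\<dots> \<le> - R' y"
      unfolding R'_def minus_divide_left[symmetric] minus_minus
      by (intro divide_right_mono) (use that in \<open>auto simp: algebra_simps power2_eq_square power4_eq_xxxx intro!: add_nonneg_nonneg\<close>)
    finally show ?thesis using 1 by linarith
  qed
  have "emeasure std_normal_distribution {x<..} = (\<integral>\<^sup>+y. ennreal (std_normal_density y) * indicator {x<..} y \<partial>lborel)"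
    by (subst emeasure_density) auto
  also have "\<dots> \<le> (\<integral>\<^sup>+y. ennreal (g y) * indicator {x..} y \<partial>lborel)"
  proof (rule nn_integral_mono)
    fix y
    show "ennreal (std_normal_density y) * indicator {x<..} y \<le> ennreal (g y) * indicator {x..} y"
    proof (cases "x < y")
      case True
      then have "std_normal_density y * 1 \<le> g y"
        unfolding g_def using ge1[of y] assms by (intro mult_left_mono) auto
      then show ?thesis using True by (simp add: ennreal_leI)
    qed simp
  qed
  also have "\<dots> = ennreal (0 - (- (std_normal_density x * R x)))"
  proof (rule nn_integral_FTC_atLeast)
    show "g \<in> borel_measurable borel" unfolding g_def R_def R'_def by measurable
    fix y assume y: "x \<le> y"
    then have "y > 0" using assms by simp
    then show "((\<lambda>y. - (std_normal_density y * R y)) has_real_derivative g y) (at y)"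
      unfolding g_def
      by (auto intro!: derivative_eq_intros DERIV_std_normal_density dR simp: algebra_simps)
    show "0 \<le> g y" unfolding g_def using ge1[OF \<open>y > 0\<close>] by (intro mult_nonneg_nonneg) auto
  next
    show "((\<lambda>y. - (std_normal_density y * R y)) \<longlongrightarrow> 0) at_top"
      unfolding R_def std_normal_density_def by real_asymp
  qed
  finally have "emeasure std_normal_distribution {x<..} \<le> ennreal (std_normal_density x * R x)" by simp
  then show ?thesis
    unfolding measure_def R_def[symmetric] using assms
    by (intro enn2real_leI) (auto simp: R_def intro!: mult_nonneg_nonneg divide_nonneg_nonneg)
qed

lemma std_normal_tail_168: "measure std_normal_distribution {168/100<..} < 1/20"
proof -
  \<comment> \<open>The exponent is half the square of 1.68. Six terms of the series suffice: the
    final tail bound is about 0.0483.\<close>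
  have e: "exp (14112/10000 :: real) \<ge> 408/100"
  proof -
    have "(\<Sum>k<6. (14112/10000 :: real) ^ k /\<^sub>R fact k) \<le> exp (14112/10000)"
      unfolding exp_def by (rule sum_le_suminf[OF summable_exp_generic]) auto
    then show ?thesis by (simp add: eval_nat_numeral fact_numeral field_simps)
  qed
  have s: "sqrt (2 * pi) \<ge> 5/2"
    using pi_approx by (intro real_le_rsqrt) (simp add: power2_eq_square)
  have "- (168/100)\<^sup>2 / 2 = - (14112/10000 :: real)" by (simp add: power2_eq_square)
  then have "std_normal_density (168/100) = 1 / sqrt (2 * pi) * exp (- (14112/10000))"
    unfolding std_normal_density_def by (simp only:)
  also have "\<dots> = 1 / (sqrt (2 * pi) * exp (14112/10000))"
    by (simp only: exp_minus inverse_eq_divide times_divide_times_eq mult_1)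
  also have "\<dots> \<le> 1 / (5/2 * (408/100))"
    using e s by (intro divide_left_mono mult_mono) auto
  finally have density: "std_normal_density (168/100) \<le> 1 / (102/10)" by simp
  have "measure std_normal_distribution {168/100<..} \<le>
      std_normal_density (168/100) * (((168/100)\<^sup>2 + 2) / ((168/100) ^ 3 + 3 * (168/100)))"
    by (rule std_normal_tail_le) simp
  also have "std_normal_density (168/100) * (((168/100)\<^sup>2 + 2) / ((168/100) ^ 3 + 3 * (168/100)))
      \<le> 1 / (102/10) * (((168/100)\<^sup>2 + 2) / ((168/100) ^ 3 + 3 * (168/100)))"
    by (rule mult_right_mono[OF density]) simp
  also have "\<dots> < 1/20" by (simp add: power2_eq_square power3_eq_cube)
  finally show ?thesis .
qed

subsection \<open>The hard-decision recursion\<close>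

definition bsc :: "bool \<Rightarrow> bool pmf" where
  "bsc s = map_pmf (\<lambda>c. c = s) (bernoulli_pmf (19/20))"

lemma pmf_bsc: "pmf (bsc s) b = (if b = s then 19/20 else 1/20)"
proof -
  have "pmf (bsc s) ((\<lambda>c. c = s) (b = s)) = pmf (bernoulli_pmf (19/20)) (b = s)"
    unfolding bsc_def by (intro pmf_map_inj') (auto simp: inj_on_def)
  moreover have "(\<lambda>c. c = s) (b = s) = b" by auto
  ultimately show ?thesis by (cases "b = s") auto
qed

lemma bind_unif_bool_bsc: "bind_pmf unif_bool bsc = unif_bool"
  by (rule pmf_eqI) (simp add: pmf_bind_pmf_of_set UNIV_bool pmf_bsc)

lemma pmf_bool_eqI: "pmf p True = pmf q True \<Longrightarrow> p = (q :: bool pmf)"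
  by (rule pmf_eqI, rename_tac b, case_tac b) (auto simp: pmf_False_conv_True)

text \<open>A decision may err with different probabilities under the two labels. A further
  randomised binary channel brings both to exactly 1/20, so that the induction over the depth
  closes.\<close>

lemma degrade_to_bsc:
  assumes "pmf P True \<ge> 19/20" "pmf Q False \<ge> 19/20"
  shows "\<exists>C. bind_pmf P C = bsc True \<and> bind_pmf Q C = bsc False"
proof -
  define a where "a = pmf P True"
  define b where "b = pmf Q False"
  have ab: "a \<ge> 19/20" "b \<ge> 19/20" "a \<le> 1" "b \<le> 1" using assms by (auto simp: a_def b_def pmf_le_1)
  \<comment> \<open>Cramer's rule for the probabilities of answering True after True
    (\<open>c\<close>) and after False (\<open>e\<close>); the determinant is
    \<open>a + b - 1\<close>.\<close>
  define c where "c = (19/20 * b - 1/20 * (1 - a)) / (a + b - 1)"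
  define e where "e = (1/20 * a - 19/20 * (1 - b)) / (a + b - 1)"
  have c01: "0 \<le> c" "c \<le> 1" and e01: "0 \<le> e" "e \<le> 1"
    using ab by (auto simp: c_def e_def field_simps)
  have nz: "a + b - 1 \<noteq> 0" using ab by auto
  have "c * a + e * (1 - a) = ((19/20 * b - 1/20 * (1 - a)) * a + (1/20 * a - 19/20 * (1 - b)) * (1 - a)) / (a + b - 1)"
    by (simp add: c_def e_def add_divide_distrib)
  also have "\<dots> = (19/20 * (a + b - 1)) / (a + b - 1)"
    by (rule arg_cong[where f="\<lambda>x. x / (a + b - 1)"]) (simp add: field_simps)
  finally have 1: "c * a + e * (1 - a) = 19/20" unfolding nonzero_mult_div_cancel_right[OF nz] .
  have "c * (1 - b) + e * b = ((19/20 * b - 1/20 * (1 - a)) * (1 - b) + (1/20 * a - 19/20 * (1 - b)) * b) / (a + b - 1)"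
    by (simp add: c_def e_def add_divide_distrib)
  also have "\<dots> = (1/20 * (a + b - 1)) / (a + b - 1)"
    by (rule arg_cong[where f="\<lambda>x. x / (a + b - 1)"]) (simp add: field_simps)
  finally have 2: "c * (1 - b) + e * b = 1/20" unfolding nonzero_mult_div_cancel_right[OF nz] .
  define C where "C x = bernoulli_pmf (if x then c else e)" for x
  have bind: "pmf (bind_pmf R C) True = c * pmf R True + e * pmf R False" for R :: "bool pmf"
    using c01 e01 by (simp add: pmf_bind C_def integral_measure_pmf[of UNIV] UNIV_bool)
  have "bind_pmf P C = bsc True" "bind_pmf Q C = bsc False"
    using 1 2 by (auto intro!: pmf_bool_eqI simp: bind pmf_bsc pmf_False_conv_True a_def b_def)
  then show ?thesis by blast
qed

definition noisy_edge :: "nat \<Rightarrow> real \<Rightarrow> bool \<Rightarrow> bool list pmf" where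
  "noisy_edge r lam s = bind_pmf (B_pmf r lam s) (\<lambda>xs. list_pmf (map bsc xs))"

text \<open>In the copying branch of the mixture the estimates are independent draws from
  \<open>bsc s\<close>; in the other branch uniform labels stay uniform under the channel.\<close>

lemma pmf_noisy_edge_replicate:
  assumes "0 \<le> lam" "lam \<le> 1"
  shows "pmf (noisy_edge r lam s) (replicate (r - 1) b)
    = lam * (if b = s then 19/20 else 1/20) ^ (r - 1) + (1 - lam) / 2 ^ (r - 1)"
proof -
  have "noisy_edge r lam s = bind_pmf (bernoulli_pmf lam) (\<lambda>c.
     if c then list_pmf (replicate (r - 1) (bsc s)) else list_pmf (replicate (r - 1) unif_bool))"
    unfolding noisy_edge_def B_pmf_mixture[OF assms] bind_assoc_pmf
    by (intro bind_pmf_cong refl)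
       (auto simp: bind_return_pmf bind_list_pmf_map bind_unif_bool_bsc)
  then show ?thesis
    using assms by (simp add: pmf_bind pmf_list_pmf_replicate pmf_bsc prod_list_replicate map_replicate power_divide)
qed

text \<open>Votes are counted relative to the label \<open>s\<close>, so that a nonpositive total
  counts as an error whichever label is the true one.\<close>

definition vote :: "nat \<Rightarrow> bool \<Rightarrow> bool list \<Rightarrow> real" where
  "vote n s xs = (if xs = replicate n s then 1 else if xs = replicate n (\<not> s) then -1 else 0)"

lemma vote_not: "n > 0 \<Longrightarrow> vote n (\<not> s) xs = - vote n s xs"
  by (auto simp: vote_def replicate_eq_replicate)

definition vote_pmf :: "nat \<Rightarrow> real \<Rightarrow> bool \<Rightarrow> real pmf" where
  "vote_pmf r lam s = map_pmf (vote (r - 1) s) (noisy_edge r lam s)"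

lemma set_vote_pmf: "set_pmf (vote_pmf r lam s) \<subseteq> {-1, 0, 1}"
  by (auto simp: vote_pmf_def vote_def)

lemma pmf_vote_pmf:
  assumes "0 \<le> lam" "lam \<le> 1" "r \<ge> 2"
  shows "pmf (vote_pmf r lam s) 1 = lam * (19/20) ^ (r - 1) + (1 - lam) / 2 ^ (r - 1)"
    and "pmf (vote_pmf r lam s) (-1) = lam * (1/20) ^ (r - 1) + (1 - lam) / 2 ^ (r - 1)"
proof -
  have "vote (r - 1) s -` {1} = {replicate (r - 1) s}"
    by (auto simp: vote_def split: if_splits)
  then show "pmf (vote_pmf r lam s) 1 = lam * (19/20) ^ (r - 1) + (1 - lam) / 2 ^ (r - 1)"
    using pmf_noisy_edge_replicate[OF assms(1,2), of r s s]
    by (simp add: vote_pmf_def pmf_map measure_pmf_single)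
  have "vote (r - 1) s -` {-1} = {replicate (r - 1) (\<not> s)}"
    using assms(3) by (auto simp: vote_def replicate_eq_replicate split: if_splits)
  then show "pmf (vote_pmf r lam s) (-1) = lam * (1/20) ^ (r - 1) + (1 - lam) / 2 ^ (r - 1)"
    using pmf_noisy_edge_replicate[OF assms(1,2), of r s "\<not> s"]
    by (simp add: vote_pmf_def pmf_map measure_pmf_single)
qed

lemma random_sum_vote_pmf:
  "random_sum D (vote_pmf r lam s) = map_pmf (\<lambda>hs. \<Sum>h\<leftarrow>hs. vote (r - 1) s h)
     (bind_pmf D (\<lambda>t. list_pmf (replicate t (noisy_edge r lam s))))"
proof -
  have "map_pmf sum_list (list_pmf (replicate t (vote_pmf r lam s))) =
      map_pmf (\<lambda>hs. \<Sum>h\<leftarrow>hs. vote (r - 1) s h) (list_pmf (replicate t (noisy_edge r lam s)))" for t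
    unfolding vote_pmf_def map_replicate[symmetric] map_list_pmf[symmetric]
    by (simp add: pmf.map_comp comp_def)
  then show ?thesis by (simp add: random_sum_def map_bind_pmf)
qed

text \<open>Applying the estimator of depth \<open>k\<close> to every child subtree turns each
  hyperedge into an independent \<open>noisy_edge\<close>, with the same law at every depth. The
  one-generation bound \<open>err\<close> therefore controls all depths.\<close>

lemma estimator_exists:
  assumes lam: "0 \<le> lam" "lam \<le> 1" and r: "r \<ge> 2"
    and err: "\<And>s. measure (random_sum D (vote_pmf r lam s)) {..0} \<le> 1/20"
  shows "\<exists>K. \<forall>s. bind_pmf (bcast r lam D k s) K = bsc s"
proof (induction k)
  case 0
  show ?case
    by (intro exI[of _ "\<lambda>ob. case ob of OLeaf x \<Rightarrow> bsc x | _ \<Rightarrow> bsc True"]) (simp add: bind_return_pmf)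
next
  case (Suc k)
  then obtain K where K: "\<And>s. bind_pmf (bcast r lam D k s) K = bsc s" by metis
  define votes where "votes ob = list_pmf (map (\<lambda>h. list_pmf (map K h)) (edges ob))" for ob
  define Q where "Q s = bind_pmf (bcast r lam D (Suc k) s) votes" for s
  have Q: "Q s = bind_pmf D (\<lambda>t. list_pmf (replicate t (noisy_edge r lam s)))" for s
    unfolding Q_def votes_def bcast_Suc_bind noisy_edge_def K ..
  \<comment> \<open>Ties are decided for False. Since \<open>err\<close> charges a zero total as an
    error under either label, it covers both decisions.\<close>
  define won where "won hs \<longleftrightarrow> (\<Sum>h\<leftarrow>hs. vote (r - 1) True h) > 0" for hs
  have err': "measure (Q s) {hs. (\<Sum>h\<leftarrow>hs. vote (r - 1) s h) \<le> 0} \<le> 1/20" for s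
    using err[of s] unfolding random_sum_vote_pmf Q[symmetric] by (simp add: vimage_def)
  have "pmf (map_pmf won (Q True)) False \<le> 1/20"
    using err'[of True] by (simp add: pmf_map vimage_def won_def not_less)
  moreover have "pmf (map_pmf won (Q False)) True \<le> 1/20"
  proof -
    have "(\<Sum>h\<leftarrow>hs. vote (r - 1) False h) = - (\<Sum>h\<leftarrow>hs. vote (r - 1) True h)" for hs
      using vote_not[of "r - 1" True] r by (simp add: uminus_sum_list_map comp_def)
    then have "pmf (map_pmf won (Q False)) True \<le> measure (Q False) {hs. (\<Sum>h\<leftarrow>hs. vote (r - 1) False h) \<le> 0}"
      unfolding pmf_map by (intro measure_pmf.finite_measure_mono) (auto simp: won_def)
    with err'[of False] show ?thesis by linarith
  qed
  ultimately obtain C where C: "bind_pmf (map_pmf won (Q True)) C = bsc True" "bind_pmf (map_pmf won (Q False)) C = bsc False"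
    using degrade_to_bsc[of "map_pmf won (Q True)" "map_pmf won (Q False)"] by (auto simp: pmf_False_conv_True)
  have "bind_pmf (bcast r lam D (Suc k) s) (\<lambda>ob. bind_pmf (votes ob) (\<lambda>hs. C (won hs))) = bsc s" for s
  proof -
    have "bind_pmf (bcast r lam D (Suc k) s) (\<lambda>ob. bind_pmf (votes ob) (\<lambda>hs. C (won hs))) = bind_pmf (map_pmf won (Q s)) C"
      unfolding Q_def bind_map_pmf by (simp add: bind_assoc_pmf)
    then show ?thesis using C by (cases s) auto
  qed
  then show ?case by blast
qed

section \<open>Positive information in the limit\<close>

lemma binary_info_bsc_pos: "binary_info (bsc True) (bsc False) > 0"
proof -
  have "binary_info (bsc True) (bsc False) = 1/20 * (19 * log 2 (19/10) + log 2 (1/10))"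
    unfolding binary_info_def
    by (subst lebesgue_integral_count_space_finite) (simp_all add: UNIV_bool pmf_bsc info_term_def)
  \<comment> \<open>Positivity amounts to \<open>(19/10) ^ 19 > 10\<close>.\<close>
  also have "19 * log 2 (19/10) + log 2 (1/10) = log 2 ((19/10) ^ 19 * (1/10))"
    by (subst log_mult) (simp_all add: log_nat_power)
  also have "1/20 * \<dots> > 0"
    by (intro mult_pos_pos) (simp_all add: zero_less_log_cancel_iff power_divide)
  finally show ?thesis .
qed

lemma reconstructibleI:
  assumes "\<And>k. \<exists>K. \<forall>s. bind_pmf (bcast r lam D k s) K = bsc s"
  shows "reconstructible r lam D"
proof -
  define X where "X k = binary_info (bcast r lam D k True) (bcast r lam D k False)" for k
  have MI: "boht_MI r lam D = X"
    unfolding boht_MI_def boht_joint_def X_def by (intro ext mutual_information_binary_info)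
  have "decseq X"
  proof (rule decseq_SucI)
    fix k
    obtain E where E: "\<And>s. bcast r lam D (Suc k) s = bind_pmf (bcast r lam D k s) E"
      using bcast_Suc_degraded by metis
    show "X (Suc k) \<le> X k"
      unfolding X_def E by (rule binary_info_data_processing)
  qed
  moreover have lower: "binary_info (bsc True) (bsc False) \<le> X k" for k
  proof -
    obtain K where K: "\<And>s. bind_pmf (bcast r lam D k s) K = bsc s" using assms by metis
    show ?thesis unfolding X_def K[symmetric] by (rule binary_info_data_processing)
  qed
  ultimately obtain L where L: "X \<longlonglongrightarrow> L"
    using decseq_convergent[of X "binary_info (bsc True) (bsc False)"] by blast
  then have "binary_info (bsc True) (bsc False) \<le> L"
    using lower by (intro LIMSEQ_le_const) auto
  with L binary_info_bsc_pos show ?thesis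
    unfolding reconstructible_def MI by (intro exI[of _ L]) auto
qed

section \<open>Error probability just below the Kesten-Stigum threshold\<close>

text \<open>
  The squared mean-to-deviation ratio of the total vote. For 6 children the right-hand side is about
  2.853, against 2.8224 on the left; the error rate 1/20 of the channel was chosen so that
  this tight case works.
\<close>
lemma signal_to_noise_gt:
  assumes "n \<ge> 6"
  shows "(168/100)\<^sup>2 < 99/100 / real n * (2 ^ n / 2) * ((19/20) ^ n - (1/20) ^ n)\<^sup>2"
  using assms
proof (induction n rule: dec_induct)
  case base
  show ?case by (simp add: power2_eq_square power_divide)
next
  case (step n)
  define A where "A = (19/20 :: real) ^ n - (1/20) ^ n"
  have A: "A \<ge> 0" unfolding A_def by (simp add: power_mono)
  \<comment> \<open>One more child multiplies the right-hand side by at least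
    \<open>2 * n / (n + 1) * (19/20)\<^sup>2\<close>, which is at least 1.\<close>
  have "(19/20) * A \<le> (19/20) ^ Suc n - (1/20) ^ Suc n"
    unfolding A_def by (simp add: right_diff_distrib)
  then have "((19/20) * A)\<^sup>2 \<le> ((19/20) ^ Suc n - (1/20) ^ Suc n)\<^sup>2"
    using A by (intro power_mono) auto
  moreover have "1 / real n \<le> (2 / real (Suc n)) * (19/20)\<^sup>2"
    using step by (simp add: field_simps power2_eq_square)
  ultimately have "(1 / real n) * A\<^sup>2 \<le> (2 / real (Suc n)) * ((19/20) ^ Suc n - (1/20) ^ Suc n)\<^sup>2"
  proof -
    assume 1: "((19/20) * A)\<^sup>2 \<le> ((19/20) ^ Suc n - (1/20) ^ Suc n)\<^sup>2"
      and 2: "1 / real n \<le> (2 / real (Suc n)) * (19/20)\<^sup>2"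
    have "(1 / real n) * A\<^sup>2 \<le> ((2 / real (Suc n)) * (19/20)\<^sup>2) * A\<^sup>2"
      by (rule mult_right_mono[OF 2]) simp
    also have "\<dots> = (2 / real (Suc n)) * ((19/20) * A)\<^sup>2" by (simp only: power_mult_distrib mult.assoc)
    also have "\<dots> \<le> (2 / real (Suc n)) * ((19/20) ^ Suc n - (1/20) ^ Suc n)\<^sup>2"
      by (rule mult_left_mono[OF 1]) simp
    finally show ?thesis .
  qed
  from mult_left_mono[OF this, of "99/100 * (2 ^ n / 2)"] step.IH
  show ?case unfolding A_def[symmetric] by (simp only: power_Suc[of 2]) (simp add: mult_ac)
qed

text \<open>
  Any constant below 1 and above about 0.98 would do in place of 99/100.
\<close>
definition sub_KS :: "nat \<Rightarrow> real \<Rightarrow> real" where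
  "sub_KS r d = sqrt (99/100 / (real (r - 1) * d))"

lemma sub_KS_bounds:
  assumes "r \<ge> 2" "d \<ge> 1"
  shows "0 \<le> sub_KS r d" "sub_KS r d \<le> 1" "real (r - 1) * d * (sub_KS r d)\<^sup>2 = 99/100"
proof -
  define q where "q = real (r - 1) * d"
  have "1 * 1 \<le> real (r - 1) * d" using assms by (intro mult_mono) auto
  then have "q \<ge> 1" unfolding q_def by (simp only: mult_1)
  then show "0 \<le> sub_KS r d" "sub_KS r d \<le> 1" "real (r - 1) * d * (sub_KS r d)\<^sup>2 = 99/100"
    unfolding sub_KS_def q_def[symmetric] by auto
qed

lemma vote_error_small:
  assumes r: "r \<ge> 7" and d: "filterlim d at_top sequentially" and D: "poisson_like d D"
  shows "eventually (\<lambda>k. measure (random_sum (D k) (vote_pmf r (sub_KS r (d k)) s)) {..0} < 1/20) sequentially"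
proof -
  define n where "n = r - 1"
  have n: "n \<ge> 6" using r by (simp add: n_def)
  define A where "A = (19/20 :: real) ^ n - (1/20) ^ n"
  have A: "A \<ge> 0" unfolding A_def by (simp add: power_mono)
  \<comment> \<open>The limiting probability of unanimity: as \<open>lam k\<close> tends to 0, each
    of the two patterns has probability \<open>1 / 2 ^ n\<close>.\<close>
  define v where "v = 2 / (2 :: real) ^ n"
  \<comment> \<open>The drift \<open>sqrt (d k) * lam k * A\<close>. The choice of
    \<open>sub_KS\<close> makes \<open>sqrt (d k) * lam k\<close> constant once
    \<open>d k \<ge> 1\<close>, so the means are eventually equal to \<open>m\<close>.\<close>
  define m where "m = sqrt (99/100 / real n) * A"
  have v: "v > 0" by (simp add: v_def)
  define lam where "lam k = sub_KS r (d k)" for k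
  define p where "p k = vote_pmf r (lam k) s" for k
  have d1: "eventually (\<lambda>k. d k \<ge> 1) sequentially"
    using d by (simp add: filterlim_at_top)
  have lam0: "lam \<longlonglongrightarrow> 0"
  proof -
    have "((\<lambda>x. sqrt (99/100 / (real n * x))) \<longlongrightarrow> 0) at_top"
      using n by real_asymp
    from filterlim_compose[OF this d] show ?thesis by (simp add: lam_def[abs_def] sub_KS_def n_def)
  qed
  have pmf_p: "eventually (\<lambda>k. pmf (p k) 1 = lam k * (19/20) ^ n + (1 - lam k) / 2 ^ n \<and>
      pmf (p k) (-1) = lam k * (1/20) ^ n + (1 - lam k) / 2 ^ n) sequentially"
    using d1
  proof eventually_elim
    case (elim k)
    then show ?case
      using pmf_vote_pmf[of "lam k" r s] sub_KS_bounds[of r "d k"] r by (simp add: p_def lam_def n_def)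
  qed
  have "(\<lambda>k. (lam k * (19/20) ^ n + (1 - lam k) / 2 ^ n) + (lam k * (1/20) ^ n + (1 - lam k) / 2 ^ n))
      \<longlonglongrightarrow> (0 * (19/20) ^ n + (1 - 0) / 2 ^ n) + (0 * (1/20) ^ n + (1 - 0) / 2 ^ n)"
    by (intro tendsto_intros lam0) auto
  then have "(\<lambda>k. (lam k * (19/20) ^ n + (1 - lam k) / 2 ^ n) + (lam k * (1/20) ^ n + (1 - lam k) / 2 ^ n)) \<longlonglongrightarrow> v"
    by (simp add: v_def)
  then have var: "(\<lambda>k. pmf (p k) 1 + pmf (p k) (-1)) \<longlonglongrightarrow> v"
    by (rule Lim_transform_eventually) (use pmf_p in eventually_elim, simp)
  have mean: "(\<lambda>k. sqrt (d k) * (pmf (p k) 1 - pmf (p k) (-1))) \<longlonglongrightarrow> m"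
  proof (rule tendsto_eventually)
    show "eventually (\<lambda>k. sqrt (d k) * (pmf (p k) 1 - pmf (p k) (-1)) = m) sequentially"
      using pmf_p d1
    proof eventually_elim
      case (elim k)
      have "pmf (p k) 1 - pmf (p k) (-1) = lam k * A"
        using elim(1) by (simp add: A_def right_diff_distrib)
      moreover have "sqrt (d k) * lam k = sqrt (99/100 / real n)"
        using elim(2) by (simp add: lam_def sub_KS_def n_def flip: real_sqrt_mult)
      ultimately show ?case by (simp add: m_def)
    qed
  qed
  have m: "168/100 < m / sqrt v"
  proof -
    have "(168/100)\<^sup>2 < 99/100 / real n * (2 ^ n / 2) * A\<^sup>2"
      unfolding A_def by (rule signal_to_noise_gt[OF n])
    also have "\<dots> = (m / sqrt v)\<^sup>2"
      using n by (simp add: m_def v_def power_divide power_mult_distrib)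
    finally show ?thesis
      by (rule power_less_imp_less_base) (use A v in \<open>auto simp: m_def\<close>)
  qed
  let ?M = "\<lambda>k. distr (random_sum (D k) (p k)) borel (\<lambda>x. m / sqrt v - x / sqrt (v * d k))"
  have "weak_conv_m ?M std_normal_distribution"
    by (rule weak_conv_ternary_sum[OF d D _ v var mean]) (simp add: p_def set_vote_pmf)
  \<comment> \<open>Weak convergence gives convergence of the distribution functions at continuity
    points; the normal law has no atom at 1.68.\<close>
  moreover have "isCont (cdf std_normal_distribution) (168/100)"
  proof -
    interpret real_distribution std_normal_distribution by (rule real_dist_normal_dist)
    have "emeasure std_normal_distribution {168/100} = 0"
      by (subst emeasure_density) (auto simp: nn_integral_null_set)
    then show ?thesis by (simp add: isCont_cdf measure_def)
  qed
  ultimately have cdf_lim: "(\<lambda>k. cdf (?M k) (168/100)) \<longlonglongrightarrow> cdf std_normal_distribution (168/100)"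
    unfolding weak_conv_m_def weak_conv_def by blast
  have "cdf std_normal_distribution (168/100) > 19/20"
  proof -
    interpret real_distribution std_normal_distribution by (rule real_dist_normal_dist)
    have "UNIV - {..168/100} = {168/100 :: real<..}" by auto
    then have "measure std_normal_distribution {168/100<..} = 1 - cdf std_normal_distribution (168/100)"
      using prob_compl[of "{..168/100}"] by (simp add: cdf_def)
    with std_normal_tail_168 show ?thesis by linarith
  qed
  from order_tendstoD(1)[OF cdf_lim this] have "eventually (\<lambda>k. cdf (?M k) (168/100) > 19/20) sequentially" .
  then show ?thesis
    using d1
  proof eventually_elim
    case (elim k)
    let ?S = "random_sum (D k) (p k)"
    have "cdf (?M k) (168/100) = measure ?S ((\<lambda>x. m / sqrt v - x / sqrt (v * d k)) -` {..168/100})"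
      by (simp add: cdf_def measure_distr)
    also have "\<dots> \<le> measure ?S (- {..0})"
    proof (rule measure_pmf.finite_measure_mono)
      \<comment> \<open>A total \<open>x \<le> 0\<close> puts the normalised value at or above
        \<open>m / sqrt v\<close>, which exceeds 1.68.\<close>
      show "(\<lambda>x. m / sqrt v - x / sqrt (v * d k)) -` {..168/100} \<subseteq> - {..0}"
      proof (intro subsetI ComplI)
        fix x assume x: "x \<in> (\<lambda>x. m / sqrt v - x / sqrt (v * d k)) -` {..168/100}" "x \<in> {..0}"
        then have "x / sqrt (v * d k) \<le> 0" using v elim by (intro divide_nonpos_nonneg) auto
        with x m show False by simp
      qed
    qed simp
    also have "\<dots> = 1 - measure ?S {..0}"
      using measure_pmf.prob_compl[of "{..0}" ?S] by (simp add: Compl_eq_Diff_UNIV)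
    finally show ?case using elim by (simp add: p_def lam_def)
  qed
qed

text \<open>The limit theorem concerns sequences, while the threshold must be uniform over real
  \<open>d\<close>. A failure would supply a counterexample \<open>X k \<ge> k\<close> for every
  \<open>k\<close>, hence a sequence tending to infinity.\<close>

lemma eventually_at_top_sequential:
  fixes P :: "real \<Rightarrow> bool"
  assumes "\<And>X. filterlim X at_top sequentially \<Longrightarrow> eventually (\<lambda>k. P (X k)) sequentially"
  shows "eventually P at_top"
proof (rule ccontr)
  assume "\<not> eventually P at_top"
  then have "\<forall>k::nat. \<exists>x\<ge>real k. \<not> P x" by (auto simp: eventually_at_top_linorder)
  then obtain X where X: "\<And>k. X k \<ge> real k" "\<And>k. \<not> P (X k)" by metis
  have "filterlim X at_top sequentially"
    by (rule filterlim_at_top_mono[OF filterlim_real_sequentially]) (simp add: X)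
  from assms[OF this] X(2) show False by simp
qed

theorem theorem4:
  fixes r :: nat
  assumes "r \<ge> 7"
  shows "\<exists>d0::real. \<forall>d::real. d \<ge> d0 \<longrightarrow>
           (\<exists>lam::real. 0 \<le> lam \<and> lam \<le> 1 \<and> real (r - 1) * d * lam\<^sup>2 < 1 \<and>
              (d \<in> \<nat> \<longrightarrow> reconstructible r lam (return_pmf (nat \<lfloor>d\<rfloor>))) \<and>
              reconstructible r lam (poisson_pmf d))"
proof -
  let ?small = "\<lambda>D d. \<forall>s. measure (random_sum D (vote_pmf r (sub_KS r d) s)) {..0} < 1/20"
  have "eventually (\<lambda>d. ?small (poisson_pmf d) d) at_top"
  proof (rule eventually_at_top_sequential)
    fix X :: "nat \<Rightarrow> real" assume X: "filterlim X at_top sequentially"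
    show "eventually (\<lambda>k. ?small (poisson_pmf (X k)) (X k)) sequentially"
      using vote_error_small[OF assms X poisson_like_poisson[OF X]]
      by (simp add: all_bool_eq eventually_conj_iff)
  qed
  then obtain d1 where d1: "\<And>d. d \<ge> d1 \<Longrightarrow> ?small (poisson_pmf d) d"
    by (auto simp: eventually_at_top_linorder)
  \<comment> \<open>Constant offspring concern integer \<open>d\<close> only, so the single sequence
    of the naturals is enough.\<close>
  have "eventually (\<lambda>k. ?small (return_pmf k) (real k)) sequentially"
    using vote_error_small[OF assms filterlim_real_sequentially poisson_like_fixed]
    by (simp add: all_bool_eq eventually_conj_iff)
  then obtain d2 where d2: "\<And>k. k \<ge> d2 \<Longrightarrow> ?small (return_pmf k) (real k)"
    by (auto simp: eventually_sequentially)
  show ?thesis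
  \<comment> \<open>The witness joins both thresholds, and the 1 keeps \<open>sub_KS r d\<close> at
    most 1. The same \<lambda> then serves both offspring laws.\<close>
  proof (rule exI[of _ "max 1 (max d1 (real d2))"], intro allI impI)
    fix d assume d: "max 1 (max d1 (real d2)) \<le> d"
    let ?lam = "sub_KS r d"
    have lam: "0 \<le> ?lam" "?lam \<le> 1" "real (r - 1) * d * ?lam\<^sup>2 = 99/100"
      using sub_KS_bounds[of r d] assms d by auto
    then have below: "real (r - 1) * d * ?lam\<^sup>2 < 1" by linarith
    have rec: "reconstructible r ?lam D" if "?small D d" for D
      using lam assms that by (intro reconstructibleI estimator_exists) (auto intro: less_imp_le)
    have "reconstructible r ?lam (return_pmf (nat \<lfloor>d\<rfloor>))" if nat: "d \<in> \<nat>"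
    proof -
      obtain k where k: "d = real k" using nat by (rule Nats_cases)
      with d have "k \<ge> d2" by simp
      from rec[of "return_pmf k"] d2[OF this] show ?thesis by (simp add: k)
    qed
    moreover have "reconstructible r ?lam (poisson_pmf d)"
      using d by (intro rec d1) simp
    ultimately show "\<exists>lam. 0 \<le> lam \<and> lam \<le> 1 \<and> real (r - 1) * d * lam\<^sup>2 < 1 \<and>
        (d \<in> \<nat> \<longrightarrow> reconstructible r lam (return_pmf (nat \<lfloor>d\<rfloor>))) \<and> reconstructible r lam (poisson_pmf d)"
      using lam(1,2) below by blast
  qed
qed

end
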